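(* Let $(L,[\cdot,\cdot],\alpha)$ be a multiplicative Hom-Lie superalgebra over $\mathbf K$, let $U$ be a $\mathbb Z_2$-graded subspace of $L$ with $L=U\oplus[L,L]$, let $\breve L=Lt\oplus Lt^2$ be the associated Hom-Lie superalgebra with twist $\breve\alpha$, and let $\varphi$ be the map on $\mathrm{QDer}(L)$ given by $$\varphi(D)(at+bt^2+ut^2)=D(a)t+D'(b)t^2\qquad(a\in L,\ b\in[L,L],\ u\in U),$$ where $D'$ is an endomorphism associated with $D$ in the definition of quasiderivation. Then: (1) $\varphi$ is homogeneous of degree $\bar 0$ (even). (2) $\varphi$ is injective, and $\varphi(D)$ does not depend on the choice of $D'$. (3) $\varphi(\mathrm{QDer}(L))\subseteq\mathrm{Der}(\breve L)$.
   Context: $\mathbf K$ is a field of characteristic zero. For a $\mathbb Z_2$-graded space $V$, $\mathrm{hg}(V)$ is the set of homogeneous elements, and in exponents of $-1$ a homogeneous element or map stands for its degree. A Hom-Lie superalgebra $(L,[\cdot,\cdot],\alpha)$ is a $\mathbb Z_2$-graded space $L=L_{\bar 0}\oplus L_{\bar 1}$ with an even bilinear map $[\cdot,\cdot]:L\times L\to L$ and an even linear map $\alpha:L\to L$ such that for homogeneous $x,y,z$: $[x,y]=-(-1)^{xy}[y,x]$ and $(-1)^{zx}[\alpha(x),[y,z]]+(-1)^{xy}[\alpha(y),[z,x]]+(-1)^{yz}[\alpha(z),[x,y]]=0$. It is multiplicative if $\alpha[x,y]=[\alpha x,\alpha y]$ for all $x,y\in L$. $\mathrm{End}_\theta(L)$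 is the space of linear maps $L\to L$ homogeneous of degree $\theta\in\mathbb Z_2$. For $k\ge 0$ define graded subspaces of $\mathrm{End}(L)$, each spanned by the homogeneous $D\in\mathrm{End}_\theta(L)$ ($\theta\in\mathbb Z_2$) satisfying $D\alpha=\alpha D$ and the stated condition for all $x\in\mathrm{hg}(L)$, $y\in L$: - $\mathrm{Der}_{\alpha^k}(L)$: $[D(x),\alpha^k(y)]+(-1)^{\theta x}[\alpha^k(x),D(y)]=D([x,y])$. - $\mathrm{QDer}_{\alpha^k}(L)$: there exists $D'\in\mathrm{End}_\theta(L)$ commuting with $\alpha$ such that $[D(x),\alpha^k(y)]+(-1)^{\theta x}[\alpha^k(x),D(y)]=D'([x,y])$. Put $\mathrm{Der}(L)=\bigoplus_{k\ge0}\mathrm{Der}_{\alpha^k}(L)$ and $\mathrm{QDer}(L)=\bigoplus_{k\ge0}\mathrm{QDer}_{\alpha^k}(L)$, direct sums indexed by $k$. The same definitions apply to $\breve L$ with $\breve\alpha$ in place of $\alpha$. $\breve L=L\otimes(t\mathbf K[t]/(t^3))=Lt\oplus Lt^2$, where $xt=x\otimes t$, $xt^2=x\otimes t^2$, graded by $\breve L_g=L_gt\oplus L_gt^2$, with bracket $[xt^i,yt^j]=[x,y]t^{i+j}$ ($t^m=0$ for $m\ge3$) and twist $\breve\alpha(xt+yt^2)=\alpha(x)t+\alpha(y)t^2$; it is a Hom-Lie superalgebra. $[L,L]$ is the span of all brackets. With $L=U\oplus[L,L]$ one has $\breve L=Lt\oplus[L,L]t^2\oplus Ut^2$. The map $\varphi$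 is defined summand by summand in $k$ and extended linearly: for homogeneous $D\in\mathrm{QDer}_{\alpha^k}(L)$, $\varphi(D)\in\mathrm{End}(\breve L)$ is given by the displayed formula, where $D'$ is an endomorphism of the same degree as $D$, commuting with $\alpha$, satisfying the identity $[D(x),\alpha^k(y)]+(-1)^{Dx}[\alpha^k(x),D(y)]=D'([x,y])$ (for that $k$), and $\varphi(D)$ is placed in the $k$-th degree; thus injectivity and the inclusion in (3) are understood for each $k$: $\varphi$ is injective on $\mathrm{QDer}_{\alpha^k}(L)$ and $\varphi(\mathrm{QDer}_{\alpha^k}(L))\subseteq\mathrm{Der}_{\breve\alpha^k}(\breve L)$.
   Formalization: Part (3) is proved under the added hypothesis α(U) ⊆ U, which is necessary for (3): for D = id, k = 0, φ(D) commutes with the twist of L̆ only if α(U) ⊆ U, and this can fail (Heisenberg algebra, α: x ↦ x+z, U = span(x,y)). *)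

theory Defs
  imports Complex_Main "HOL-Library.Z2" "HOL-Library.Product_Plus" "HOL-Library.Function_Algebras"
begin

text \<open>
  The space \<open>L\<close> is the whole type \<open>'a\<close>, with scalar multiplication \<open>smult\<close>. The degree group is
  the type \<^typ>\<open>bit\<close> of integers modulo 2.
\<close>

record ('k, 'a) hom_superalg =
  smult :: "'k \<Rightarrow> 'a \<Rightarrow> 'a"
  gr :: "bit \<Rightarrow> 'a set"
  brk :: "'a \<Rightarrow> 'a \<Rightarrow> 'a"
  tw :: "'a \<Rightarrow> 'a"

definition sgn2 :: "bit \<Rightarrow> 'k::field" where
  "sgn2 d = (if d = 0 then 1 else - 1)"

definition direct_decomp :: "'a::ab_group_add set \<Rightarrow> 'a set \<Rightarrow> bool" where
  "direct_decomp V W \<longleftrightarrow> V \<inter> W = {0} \<and> (\<forall>x. \<exists>v\<in>V. \<exists>w\<in>W. x = v + w)"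

locale hom_lie_superalgebra = vector_space "smult A"
  for A :: "('k::field_char_0, 'a::ab_group_add) hom_superalg" +
  assumes subspace_gr: "subspace (gr A i)"
    and decomp_gr: "direct_decomp (gr A 0) (gr A 1)"
    and linear_brk_right: "Vector_Spaces.linear (smult A) (smult A) (brk A x)"
    and linear_brk_left: "Vector_Spaces.linear (smult A) (smult A) (\<lambda>x. brk A x y)"
    and brk_gr: "x \<in> gr A i \<Longrightarrow> y \<in> gr A j \<Longrightarrow> brk A x y \<in> gr A (i + j)"
    and linear_tw: "Vector_Spaces.linear (smult A) (smult A) (tw A)"
    and tw_gr: "x \<in> gr A i \<Longrightarrow> tw A x \<in> gr A i"
    and super_skew: "x \<in> gr A i \<Longrightarrow> y \<in> gr A j \<Longrightarrow>
          brk A x y = - smult A (sgn2 (i * j)) (brk A y x)"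
    and hom_jacobi: "x \<in> gr A i \<Longrightarrow> y \<in> gr A j \<Longrightarrow> z \<in> gr A l \<Longrightarrow>
          smult A (sgn2 (l * i)) (brk A (tw A x) (brk A y z))
        + smult A (sgn2 (i * j)) (brk A (tw A y) (brk A z x))
        + smult A (sgn2 (j * l)) (brk A (tw A z) (brk A x y)) = 0"

locale multiplicative_hom_lie_superalgebra = hom_lie_superalgebra +
  assumes multiplicative: "tw A (brk A x y) = brk A (tw A x) (tw A y)"

definition derived :: "('k::field_char_0, 'a::ab_group_add) hom_superalg \<Rightarrow> 'a set" where
  "derived A = module.span (smult A) {brk A x y |x y. True}"

definition graded_subspace :: "('k::field_char_0, 'a::ab_group_add) hom_superalg \<Rightarrow> 'a set \<Rightarrow> bool" where
  "graded_subspace A U \<longleftrightarrow> module.subspace (smult A) U \<and>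
     (\<forall>u\<in>U. \<exists>u0 \<in> U \<inter> gr A 0. \<exists>u1 \<in> U \<inter> gr A 1. u = u0 + u1)"

text \<open>The space of all maps \<open>L \<rightarrow> L\<close> carries the pointwise operations.\<close>

abbreviation smult_fun :: "('k, 'a) hom_superalg \<Rightarrow> 'k \<Rightarrow> ('b \<Rightarrow> 'a) \<Rightarrow> 'b \<Rightarrow> 'a" where
  "smult_fun A c f \<equiv> \<lambda>x. smult A c (f x)"

definition hom_end :: "('k::field_char_0, 'a::ab_group_add) hom_superalg \<Rightarrow> bit \<Rightarrow> ('a \<Rightarrow> 'a) set" where
  "hom_end A \<theta> = {D. Vector_Spaces.linear (smult A) (smult A) D \<and> (\<forall>i. D ` gr A i \<subseteq> gr A (\<theta> + i))}"

definition comm_end :: "('k::field_char_0, 'a::ab_group_add) hom_superalg \<Rightarrow> bit \<Rightarrow> ('a \<Rightarrow> 'a) set" where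
  "comm_end A \<theta> = {D \<in> hom_end A \<theta>. D \<circ> tw A = tw A \<circ> D}"

definition der_identity ::
    "('k::field_char_0, 'a::ab_group_add) hom_superalg \<Rightarrow> nat \<Rightarrow> bit \<Rightarrow> ('a \<Rightarrow> 'a) \<Rightarrow> ('a \<Rightarrow> 'a) \<Rightarrow> bool" where
  "der_identity A k \<theta> D D' \<longleftrightarrow> (\<forall>i. \<forall>x\<in>gr A i. \<forall>y.
     brk A (D x) ((tw A ^^ k) y) + smult A (sgn2 (\<theta> * i)) (brk A ((tw A ^^ k) x) (D y))
       = D' (brk A x y))"

definition Der_at :: "('k::field_char_0, 'a::ab_group_add) hom_superalg \<Rightarrow> nat \<Rightarrow> ('a \<Rightarrow> 'a) set" where
  "Der_at A k = module.span (smult_fun A) {D. \<exists>\<theta>. D \<in> comm_end A \<theta> \<and> der_identity A k \<theta> D D}"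

definition QDer_at :: "('k::field_char_0, 'a::ab_group_add) hom_superalg \<Rightarrow> nat \<Rightarrow> ('a \<Rightarrow> 'a) set" where
  "QDer_at A k = module.span (smult_fun A)
     {D. \<exists>\<theta>. D \<in> comm_end A \<theta> \<and> (\<exists>D'\<in>comm_end A \<theta>. der_identity A k \<theta> D D')}"

text \<open>
  External direct sums over \<open>k\<close>: the summands \<open>Der_at A k\<close> may overlap inside the space of
  endomorphisms, so an element of the direct sum is a finitely supported family.
\<close>

definition dsum :: "(nat \<Rightarrow> 'e::zero set) \<Rightarrow> (nat \<Rightarrow> 'e) set" where
  "dsum S = {F. finite {k. F k \<noteq> 0} \<and> (\<forall>k. F k \<in> S k)}"

definition Der :: "('k::field_char_0, 'a::ab_group_add) hom_superalg \<Rightarrow> (nat \<Rightarrow> 'a \<Rightarrow> 'a) set" where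
  "Der A = dsum (Der_at A)"

definition QDer :: "('k::field_char_0, 'a::ab_group_add) hom_superalg \<Rightarrow> (nat \<Rightarrow> 'a \<Rightarrow> 'a) set" where
  "QDer A = dsum (QDer_at A)"

text \<open>The pair \<open>(a, b)\<close> stands for \<open>a t + b t\<^sup>2\<close>; a bracket has no \<open>t\<close>-component, and \<open>t\<^sup>3 = 0\<close>.\<close>

definition breve :: "('k::field_char_0, 'a::ab_group_add) hom_superalg \<Rightarrow> ('k, 'a \<times> 'a) hom_superalg" where
  "breve A =
     \<lparr> smult = (\<lambda>c (a, b). (smult A c a, smult A c b)),
       gr = (\<lambda>i. gr A i \<times> gr A i),
       brk = (\<lambda>(a, b) (c, d). (0, brk A a c)),
       tw = (\<lambda>(a, b). (tw A a, tw A b)) \<rparr>"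

lemma vector_space_breve:
  fixes A :: "('k::field_char_0, 'a::ab_group_add) hom_superalg"
  assumes "vector_space (smult A)"
  shows "vector_space (smult (breve A))"
proof -
  interpret vector_space "smult A" by fact
  show ?thesis by unfold_locales (auto simp: breve_def scale_right_distrib scale_left_distrib)
qed

lemma lin_iff:
  fixes A :: "('k::field_char_0, 'a::ab_group_add) hom_superalg"
  assumes "vector_space (smult A)"
  shows "Vector_Spaces.linear (smult A) (smult A) f \<longleftrightarrow>
    (\<forall>x y. f (x + y) = f x + f y) \<and> (\<forall>c x. f (smult A c x) = smult A c (f x))"
  using assms by (auto simp: Vector_Spaces.linear_def module_hom_def module_hom_axioms_def vector_space_def module_def linear_def)

lemma breve_sel:
  "smult (breve A) c v = (smult A c (fst v), smult A c (snd v))"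
  "brk (breve A) v w = (0, brk A (fst v) (fst w))"
  "tw (breve A) v = (tw A (fst v), tw A (snd v))"
  "v \<in> gr (breve A) i \<longleftrightarrow> fst v \<in> gr A i \<and> snd v \<in> gr A i"
  by (simp_all add: breve_def split_beta mem_Times_iff)

lemma hom_lie_superalgebra_breve:
  assumes "hom_lie_superalgebra A"
  shows "hom_lie_superalgebra (breve A)"
proof -
  interpret hom_lie_superalgebra A by fact
  have vs: "vector_space (smult A)" by unfold_locales
  interpret B: vector_space "smult (breve A)" by (rule vector_space_breve[OF vs])
  note vb = vector_space_breve[OF vs]
  have z[simp]: "brk A 0 x = 0" "brk A x 0 = 0" for x
    using linear_brk_left[of x] linear_brk_right[of x] unfolding lin_iff[OF vs] by (metis add_cancel_left_left)+
  show ?thesis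
  proof (intro hom_lie_superalgebra.intro hom_lie_superalgebra_axioms.intro)
    show "vector_space (smult (breve A))" by (rule vb)
    show "B.subspace (gr (breve A) i)" for i
      using subspace_gr[of i] unfolding B.subspace_def subspace_def by (auto simp: breve_def zero_prod_def)
    show "direct_decomp (gr (breve A) 0) (gr (breve A) 1)"
      using decomp_gr unfolding direct_decomp_def
      by (auto simp: breve_def zero_prod_def set_eq_iff)
    show "Vector_Spaces.linear (smult (breve A)) (smult (breve A)) (brk (breve A) x)" for x
      using linear_brk_right unfolding lin_iff[OF vs] lin_iff[OF vb]
      by (auto simp: breve_def split: prod.splits)
    show "Vector_Spaces.linear (smult (breve A)) (smult (breve A)) (\<lambda>x. brk (breve A) x y)" for y
      using linear_brk_left unfolding lin_iff[OF vs] lin_iff[OF vb]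
      by (auto simp: breve_def split: prod.splits)
    show "Vector_Spaces.linear (smult (breve A)) (smult (breve A)) (tw (breve A))"
      using linear_tw unfolding lin_iff[OF vs] lin_iff[OF vb]
      by (auto simp: breve_def split: prod.splits)
    show "brk (breve A) x y \<in> gr (breve A) (i + j)" if "x \<in> gr (breve A) i" "y \<in> gr (breve A) j" for x y i j
      using that brk_gr subspace_0[OF subspace_gr] unfolding breve_def
      by (simp add: case_prod_beta mem_Times_iff del: add_bit_eq_xor)
    show "tw (breve A) x \<in> gr (breve A) i" if "x \<in> gr (breve A) i" for x i
      using that tw_gr by (auto simp: breve_def)
    show "brk (breve A) x y = - smult (breve A) (sgn2 (i * j)) (brk (breve A) y x)"
      if "x \<in> gr (breve A) i" "y \<in> gr (breve A) j" for x y i j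
      using that super_skew[of "fst x" i "fst y" j]
      unfolding breve_sel prod_eq_iff by (simp del: mult_bit_eq_and)
  qed (simp add: breve_sel zero_prod_def del: mult_bit_eq_and)
qed

text \<open>
  \<open>phi_ext A U D D'\<close> sends \<open>a t + b t\<^sup>2 + u t\<^sup>2\<close> to \<open>D(a) t + D'(b) t\<^sup>2\<close> for \<open>b \<in> [L, L]\<close> and
  \<open>u \<in> U\<close>: the component \<open>b\<close> of \<open>c = b + u\<close> is the projection of \<open>c\<close> to \<open>[L, L]\<close> along \<open>U\<close>.
\<close>

definition phi_ext ::
    "('k::field_char_0, 'a::ab_group_add) hom_superalg \<Rightarrow> 'a set \<Rightarrow> ('a \<Rightarrow> 'a) \<Rightarrow> ('a \<Rightarrow> 'a) \<Rightarrow> 'a \<times> 'a \<Rightarrow> 'a \<times> 'a" where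
  "phi_ext A U D D' = (\<lambda>(a, c). (D a, D' (THE b. b \<in> derived A \<and> c - b \<in> U)))"

text \<open>
  \<open>\<phi>\<close> on the \<open>k\<close>-th summand: write \<open>D\<close> as a sum of homogeneous quasiderivations, choose an
  associated endomorphism for each of them, and add the resulting maps.
\<close>

definition phi_at ::
    "('k::field_char_0, 'a::ab_group_add) hom_superalg \<Rightarrow> 'a set \<Rightarrow> nat \<Rightarrow> ('a \<Rightarrow> 'a) \<Rightarrow> 'a \<times> 'a \<Rightarrow> 'a \<times> 'a" where
  "phi_at A U k D = (SOME E. \<exists>D0\<in>comm_end A 0. \<exists>D0'\<in>comm_end A 0. \<exists>D1\<in>comm_end A 1. \<exists>D1'\<in>comm_end A 1.
     der_identity A k 0 D0 D0' \<and> der_identity A k 1 D1 D1' \<and>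
     D = D0 + D1 \<and> E = phi_ext A U D0 D0' + phi_ext A U D1 D1')"

definition phi ::
    "('k::field_char_0, 'a::ab_group_add) hom_superalg \<Rightarrow> 'a set \<Rightarrow> (nat \<Rightarrow> 'a \<Rightarrow> 'a) \<Rightarrow> nat \<Rightarrow> 'a \<times> 'a \<Rightarrow> 'a \<times> 'a" where
  "phi A U F = (\<lambda>k. phi_at A U k (F k))"

text \<open>
  The identity of \<open>L\<close> is a quasiderivation for \<open>k = 0\<close>, with associated endomorphism
  \<open>b \<mapsto> b + b\<close>. Its image under \<open>\<phi>\<close> is the map \<open>E\<close> below, and it can be a derivation only
  if it commutes with the twist of \<open>breve A\<close>. Hence \<open>\<phi>\<close> takes values in the derivations only
  if \<open>U\<close> is invariant under the twist. This does not follow from \<open>L = U \<oplus> [L, L]\<close>: in the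
  Heisenberg algebra with \<open>[x, y] = z\<close>, twist \<open>x \<mapsto> x + z, y \<mapsto> y, z \<mapsto> z\<close> and
  \<open>U = span {x, y}\<close> it fails.
\<close>

lemma twist_invariance_necessary:
  assumes "hom_lie_superalgebra A" and dd: "direct_decomp U (derived A)"
    and E: "\<And>a b u. b \<in> derived A \<Longrightarrow> u \<in> U \<Longrightarrow> E (a, b + u) = (a, b + b)"
    and comm: "E \<circ> tw (breve A) = tw (breve A) \<circ> E"
  shows "tw A ` U \<subseteq> U"
proof
  interpret hom_lie_superalgebra A by fact
  have vs: "vector_space (smult A)" by unfold_locales
  have tw0: "tw A 0 = 0"
    using linear_tw[unfolded lin_iff[OF vs], THEN conjunct1, rule_format, of 0 0] by simp
  have d0: "0 \<in> derived A" unfolding derived_def by (rule span_zero)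
  fix v assume "v \<in> tw A ` U"
  then obtain u where u: "u \<in> U" "v = tw A u" by blast
  obtain w b where wb: "w \<in> U" "b \<in> derived A" "v = b + w"
    using dd unfolding direct_decomp_def by (metis add.commute)
  have "(0, b + b) = E (0, b + w)" using E[OF wb(2,1)] by simp
  also have "\<dots> = E (tw (breve A) (0, u))" by (simp add: breve_sel tw0 u(2)[symmetric] wb(3))
  also have "\<dots> = tw (breve A) (E (0, 0 + u))" using fun_cong[OF comm, of "(0, u)"] by simp
  also have "\<dots> = (0, 0)" using E[OF d0 u(1), of 0] by (simp add: breve_sel tw0)
  finally have "smult A (1 + 1) b = 0" unfolding scale_left_distrib by simp
  then have "b = 0" by simp
  then show "v \<in> U" using wb by simp
qed

end

theory Submission
  imports Defs
begin

text \<open>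
  The associated map \<open>D'\<close> is determined by \<open>D\<close> on brackets, hence on \<open>[L, L]\<close>, and a
  quasiderivation has a unique splitting into homogeneous ones. So \<open>\<phi>(D)\<close> is \<open>D\<close> on \<open>L t\<close> and
  \<open>D' \<circ> p\<close> on \<open>L t\<^sup>2\<close>, where \<open>p\<close> is the projection onto \<open>[L, L]\<close> along \<open>U\<close>. This \<open>p\<close> is even, and
  commutes with the twist once \<open>U\<close> is invariant. The bracket of \<open>L t + L t\<^sup>2\<close> only sees the
  \<open>t\<close>-components and lies in \<open>[L, L] t\<^sup>2\<close>, so the quasiderivation identity of \<open>(D, D')\<close> is the
  derivation identity of \<open>\<phi>(D)\<close>.
\<close>

section \<open>Pointwise operations on maps, and quasiderivations with their witnesses\<close>

lemma vector_space_smult_fun: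
  assumes "vector_space (smult A)"
  shows "vector_space (smult_fun A :: 'k::field \<Rightarrow> ('b \<Rightarrow> 'a::ab_group_add) \<Rightarrow> 'b \<Rightarrow> 'a)"
proof -
  interpret vector_space "smult A" by fact
  show ?thesis
    by unfold_locales (auto simp: fun_eq_iff scale_right_distrib scale_left_distrib)
qed

lemma breve_tw_power: "(tw (breve A) ^^ k) v = ((tw A ^^ k) (fst v), (tw A ^^ k) (snd v))"
  by (induction k) (simp_all add: breve_sel)

text \<open>The witness \<open>D'\<close>, existentially bound in \<open>QDer_at\<close>, is kept
  explicit here, so that a quasiderivation and its associated map can be added and scaled
  together.\<close>

definition quasi_pair ::
    "('k::field_char_0, 'a::ab_group_add) hom_superalg \<Rightarrow> nat \<Rightarrow> bit \<Rightarrow> ('a \<Rightarrow> 'a) \<Rightarrow> ('a \<Rightarrow> 'a) \<Rightarrow> bool" where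
  "quasi_pair A k \<theta> D D' \<longleftrightarrow> D \<in> comm_end A \<theta> \<and> D' \<in> comm_end A \<theta> \<and> der_identity A k \<theta> D D'"

lemma quasi_pairD:
  assumes "quasi_pair A k \<theta> D D'"
  shows "D \<in> comm_end A \<theta>" "D' \<in> comm_end A \<theta>" "D \<in> hom_end A \<theta>" "D' \<in> hom_end A \<theta>"
    "der_identity A k \<theta> D D'"
  using assms by (auto simp: quasi_pair_def comm_end_def)

section \<open>Homogeneous elements and homogeneous endomorphisms\<close>

context hom_lie_superalgebra
begin

lemma vs: "vector_space (smult A)"
  by unfold_locales

interpretation fn: vector_space "smult_fun A :: 'k \<Rightarrow> ('a \<Rightarrow> 'a) \<Rightarrow> 'a \<Rightarrow> 'a"
  by (rule vector_space_smult_fun[OF vs])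

lemma gr_exhaust:
  obtains x0 x1 where "x0 \<in> gr A 0" "x1 \<in> gr A 1" "x = x0 + x1"
  using decomp_gr unfolding direct_decomp_def by blast

lemma gr_disjoint:
  assumes "x \<in> gr A i" "x \<in> gr A j" "i \<noteq> j"
  shows "x = 0"
proof -
  have "x \<in> gr A 0 \<inter> gr A 1"
    using assms by (cases i; cases j) auto
  then show ?thesis
    using decomp_gr unfolding direct_decomp_def by blast
qed

lemma linear_comps [simp]:
  "brk A (x + y) z = brk A x z + brk A y z" "brk A x (y + z) = brk A x y + brk A x z"
  "brk A (smult A c x) z = smult A c (brk A x z)" "brk A x (smult A c z) = smult A c (brk A x z)"
  "tw A (x + y) = tw A x + tw A y" "tw A (smult A c x) = smult A c (tw A x)"
  using linear_brk_left[of z] linear_brk_right[of x] linear_tw unfolding lin_iff[OF vs] by auto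

lemma brk_zero [simp]: "brk A 0 x = 0" "brk A x 0 = 0"
  using linear_comps(3)[of 0 0 x] linear_comps(4)[of x 0 0] by simp_all

lemma tw_zero [simp]: "tw A 0 = 0"
  using linear_comps(6)[of 0 0] by simp

lemma hom_endD:
  assumes "D \<in> hom_end A \<theta>"
  shows "D (x + y) = D x + D y" "D (smult A c x) = smult A c (D x)" "D 0 = 0"
    "x \<in> gr A i \<Longrightarrow> D x \<in> gr A (\<theta> + i)"
proof -
  show *: "D (x + y) = D x + D y" "D (smult A c x) = smult A c (D x)" for x y c
    using assms unfolding hom_end_def lin_iff[OF vs] by auto
  show "D 0 = 0"
    using *(2)[of 0 0] by simp
  show "x \<in> gr A i \<Longrightarrow> D x \<in> gr A (\<theta> + i)"
    using assms unfolding hom_end_def by blast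
qed

lemma hom_endI:
  assumes "\<And>x y. D (x + y) = D x + D y" "\<And>c x. D (smult A c x) = smult A c (D x)"
    "\<And>x i. x \<in> gr A i \<Longrightarrow> D x \<in> gr A (\<theta> + i)"
  shows "D \<in> hom_end A \<theta>"
  using assms unfolding hom_end_def lin_iff[OF vs] by blast

lemma subspace_hom_end: "fn.subspace (hom_end A \<theta>)"
  unfolding fn.subspace_def
proof (intro conjI ballI allI)
  show "0 \<in> hom_end A \<theta>"
    by (rule hom_endI) (simp_all add: subspace_0[OF subspace_gr])
next
  fix D E assume DE: "D \<in> hom_end A \<theta>" "E \<in> hom_end A \<theta>"
  then show "D + E \<in> hom_end A \<theta>"
    by (intro hom_endI)
      (simp_all add: hom_endD(1,2)[OF DE(1)] hom_endD(1,2)[OF DE(2)] scale_right_distrib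
        hom_endD(4) subspace_add[OF subspace_gr] del: add_bit_eq_xor)
next
  fix D c assume D: "D \<in> hom_end A \<theta>"
  then show "smult_fun A c D \<in> hom_end A \<theta>"
    by (intro hom_endI)
      (simp_all add: hom_endD(1,2)[OF D] scale_right_distrib mult.commute
        hom_endD(4) subspace_scale[OF subspace_gr] del: add_bit_eq_xor)
qed

lemma subspace_comm_end: "fn.subspace (comm_end A \<theta>)"
  using subspace_hom_end[of \<theta>] unfolding fn.subspace_def comm_end_def
  by (auto simp: fun_eq_iff)

text \<open>Such a map sends each homogeneous element into both homogeneous components of the space,
  which meet only in 0, and every element is a sum of homogeneous ones.\<close>

lemma hom_end_disjoint:
  assumes D: "D \<in> hom_end A \<theta>" "D \<in> hom_end A \<eta>" and "\<theta> \<noteq> \<eta>"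
  shows "D = 0"
proof
  fix x
  have z: "D y = 0" if "y \<in> gr A i" for y i
    using hom_endD(4)[OF D(1) that] hom_endD(4)[OF D(2) that] \<open>\<theta> \<noteq> \<eta>\<close>
    by (auto intro: gr_disjoint simp del: add_bit_eq_xor)
  obtain x0 x1 where "x0 \<in> gr A 0" "x1 \<in> gr A 1" "x = x0 + x1"
    by (rule gr_exhaust)
  then show "D x = 0 x"
    by (simp add: hom_endD(1)[OF D(1)] z)
qed

lemma hom_end_sum_unique:
  assumes "D0 \<in> hom_end A 0" "E0 \<in> hom_end A 0" "D1 \<in> hom_end A 1" "E1 \<in> hom_end A 1"
    and eq: "D0 + D1 = E0 + E1"
  shows "D0 = E0" "D1 = E1"
proof -
  \<comment> \<open>The left side has degree 0 and the right side degree 1, so both vanish.\<close>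
  have d: "D0 - E0 = E1 - D1"
    using eq by (simp add: algebra_simps)
  have "D0 - E0 \<in> hom_end A 0" "D0 - E0 \<in> hom_end A 1"
    using assms(1-4) fn.subspace_diff[OF subspace_hom_end] unfolding d[symmetric]
    by (blast, metis d)
  then have "D0 - E0 = 0"
    by (rule hom_end_disjoint) simp
  then show "D0 = E0" "D1 = E1"
    using d by simp_all
qed

section \<open>Quasiderivations, their splitting by degree, and the grading of [L, L]\<close>

lemma quasi_pair_zero: "quasi_pair A k \<theta> 0 0"
  by (simp add: quasi_pair_def fn.subspace_0[OF subspace_comm_end] der_identity_def)

lemma quasi_pair_add:
  assumes "quasi_pair A k \<theta> D D'" "quasi_pair A k \<theta> E E'"
  shows "quasi_pair A k \<theta> (D + E) (D' + E')"
  using assms fn.subspace_add[OF subspace_comm_end]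
  unfolding quasi_pair_def der_identity_def
  by (simp add: scale_right_distrib algebra_simps del: mult_bit_eq_and)

lemma quasi_pair_scale:
  assumes "quasi_pair A k \<theta> D D'"
  shows "quasi_pair A k \<theta> (smult_fun A c D) (smult_fun A c D')"
proof -
  \<comment> \<open>Pulls \<open>c\<close> out of both terms of the identity. The rule
    \<open>scale_scale\<close> is switched off below because it would merge \<open>c\<close> with
    the sign \<open>s\<close>.\<close>
  have "smult A c u + smult A s (smult A c v) = smult A c (u + smult A s v)" for s u v
    by (simp add: scale_right_distrib mult.commute)
  then show ?thesis
    using assms fn.subspace_scale[OF subspace_comm_end]
    unfolding quasi_pair_def der_identity_def
    by (simp del: mult_bit_eq_and scale_scale)
qed

lemma subspace_derived: "subspace (derived A)"
  unfolding derived_def by simp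

lemma brk_derived: "brk A x y \<in> derived A"
  unfolding derived_def by (rule span_base) blast

text \<open>The identity prescribes the associated map on brackets with homogeneous left argument.
  Additivity extends this to all brackets, and the set where two linear maps agree is a subspace, so
  it contains their span.\<close>

lemma quasi_pair_unique:
  assumes D': "quasi_pair A k \<theta> D D'" and E': "quasi_pair A k \<theta> D E'" and b: "b \<in> derived A"
  shows "D' b = E' b"
proof -
  note D'l = hom_endD[OF quasi_pairD(4)[OF D']] and E'l = hom_endD[OF quasi_pairD(4)[OF E']]
  have hom: "D' (brk A x y) = E' (brk A x y)" if "x \<in> gr A i" for x y i
    using that D' E' unfolding quasi_pair_def der_identity_def by metis
  have brk: "D' (brk A x y) = E' (brk A x y)" for x y
  proof -
    obtain x0 x1 where "x0 \<in> gr A 0" "x1 \<in> gr A 1" "x = x0 + x1"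
      by (rule gr_exhaust)
    then show ?thesis
      using hom by (simp add: D'l(1) E'l(1))
  qed
  have "subspace {b. D' b = E' b}"
    by (rule subspaceI) (simp_all add: D'l(1-3) E'l(1-3))
  with b show ?thesis
    unfolding derived_def by (rule span_induct) (auto simp: brk)
qed

text \<open>Pairs of equal degree can be added, so any combination of generators collapses to one
  pair per degree. This is the form of splitting over which \<open>phi_at\<close> chooses.\<close>

lemma QDer_at_iff:
  "D \<in> QDer_at A k \<longleftrightarrow>
     (\<exists>D0 D0' D1 D1'. quasi_pair A k 0 D0 D0' \<and> quasi_pair A k 1 D1 D1' \<and> D = D0 + D1)"
  (is "_ \<longleftrightarrow> ?S D")
proof
  have "fn.subspace (Collect ?S)"
  proof (rule fn.subspaceI)
    have "?S 0"
      using quasi_pair_zero add.right_neutral[symmetric] by blast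
    then show "0 \<in> Collect ?S" by blast
  next
    fix D E assume "D \<in> Collect ?S" "E \<in> Collect ?S"
    then obtain D0 D0' D1 D1' E0 E0' E1 E1' where
      "quasi_pair A k 0 (D0 + E0) (D0' + E0')" "quasi_pair A k 1 (D1 + E1) (D1' + E1')"
      "D = D0 + D1" "E = E0 + E1"
      using quasi_pair_add by blast
    moreover have "D0 + D1 + (E0 + E1) = (D0 + E0) + (D1 + E1)"
      by (simp add: algebra_simps)
    ultimately show "D + E \<in> Collect ?S" by blast
  next
    fix c D assume "D \<in> Collect ?S"
    then obtain D0 D0' D1 D1' where
      "quasi_pair A k 0 (smult_fun A c D0) (smult_fun A c D0')"
      "quasi_pair A k 1 (smult_fun A c D1) (smult_fun A c D1')" "D = D0 + D1"
      using quasi_pair_scale by blast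
    then show "smult_fun A c D \<in> Collect ?S"
      using fn.scale_right_distrib by blast
  qed
  \<comment> \<open>A generator has a single degree; the zero pair serves as its part of the other
    degree.\<close>
  moreover have "?S E" if "E \<in> comm_end A \<theta>" "E' \<in> comm_end A \<theta>" "der_identity A k \<theta> E E'"
    for E E' \<theta>
  proof -
    have "quasi_pair A k \<theta> E E'"
      using that by (simp add: quasi_pair_def)
    then show ?thesis
      using quasi_pair_zero add.right_neutral[of E, symmetric] add.left_neutral[of E, symmetric]
      by (cases \<theta>) blast+
  qed
  ultimately have "QDer_at A k \<subseteq> Collect ?S"
    unfolding QDer_at_def by (intro fn.span_minimal) blast
  then show "D \<in> QDer_at A k \<Longrightarrow> ?S D" by blast
  have "E \<in> QDer_at A k" if "quasi_pair A k \<theta> E E'" for E E' \<theta>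
    using that unfolding QDer_at_def quasi_pair_def by (intro fn.span_base) blast
  then show "?S D \<Longrightarrow> D \<in> QDer_at A k"
    using fn.span_add unfolding QDer_at_def by blast
qed

text \<open>Expanding both arguments into homogeneous parts writes a bracket as a sum of four
  homogeneous brackets. Hence the sum of the two graded pieces of [L, L], a subspace, contains every
  bracket.\<close>

lemma derived_graded:
  assumes "b \<in> derived A"
  obtains b0 b1 where "b0 \<in> derived A \<inter> gr A 0" "b1 \<in> derived A \<inter> gr A 1" "b = b0 + b1"
proof -
  let ?S = "{u + v |u v. u \<in> derived A \<inter> gr A 0 \<and> v \<in> derived A \<inter> gr A 1}"
  have sub: "subspace ?S"
    by (intro subspace_sums subspace_inter subspace_derived subspace_gr)
  have hom: "brk A x y \<in> ?S" if "x \<in> gr A i" "y \<in> gr A j" for x y i j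
  proof -
    have "brk A x y \<in> derived A \<inter> gr A (i + j)"
      using brk_gr[OF that] brk_derived by blast
    moreover have "0 \<in> derived A \<inter> gr A l" for l
      using subspace_0[OF subspace_gr] subspace_0[OF subspace_derived] by blast
    ultimately show ?thesis
      using add.right_neutral[of "brk A x y", symmetric] add.left_neutral[of "brk A x y", symmetric]
      by (cases "i + j") (force simp del: add_bit_eq_xor)+
  qed
  have "brk A x y \<in> ?S" for x y
  proof -
    obtain x0 x1 where x: "x0 \<in> gr A 0" "x1 \<in> gr A 1" "x = x0 + x1"
      by (rule gr_exhaust)
    obtain y0 y1 where y: "y0 \<in> gr A 0" "y1 \<in> gr A 1" "y = y0 + y1"
      by (rule gr_exhaust)
    have "brk A x y = (brk A x0 y0 + brk A x0 y1) + (brk A x1 y0 + brk A x1 y1)"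
      by (simp add: x(3) y(3) algebra_simps)
    then show ?thesis
      using hom[OF x(1) y(1)] hom[OF x(1) y(2)] hom[OF x(2) y(1)] hom[OF x(2) y(2)]
        subspace_add[OF sub] by presburger
  qed
  then have "derived A \<subseteq> ?S"
    unfolding derived_def using sub by (intro span_minimal) (auto simp: derived_def)
  then show ?thesis
    using assms that by blast
qed

end

section \<open>The projection onto [L, L] along U\<close>

locale derived_complement = hom_lie_superalgebra A
  for A :: "('k::field_char_0, 'a::ab_group_add) hom_superalg" +
  fixes U :: "'a set"
  assumes graded_U: "graded_subspace A U"
    and decomp_U: "direct_decomp U (derived A)"
begin

interpretation fn: vector_space "smult_fun A :: 'k \<Rightarrow> ('a \<Rightarrow> 'a) \<Rightarrow> 'a \<Rightarrow> 'a"
  by (rule vector_space_smult_fun[OF vs])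

interpretation B: hom_lie_superalgebra "breve A"
  by (rule hom_lie_superalgebra_breve) unfold_locales

interpretation fnB: vector_space
  "smult_fun (breve A) :: 'k \<Rightarrow> ('a \<times> 'a \<Rightarrow> 'a \<times> 'a) \<Rightarrow> 'a \<times> 'a \<Rightarrow> 'a \<times> 'a"
  by (rule vector_space_smult_fun[OF B.vs])

lemma subspace_U: "subspace U"
  using graded_U unfolding graded_subspace_def by blast

lemma U_derived_disjoint: "x \<in> U \<Longrightarrow> x \<in> derived A \<Longrightarrow> x = 0"
  using decomp_U unfolding direct_decomp_def by blast

text \<open>Repeats the description inside \<open>phi_ext\<close>, so that the second component of
  \<open>phi_ext\<close> becomes \<open>D'\<close> after \<open>proj\<close>.\<close>

definition proj :: "'a \<Rightarrow> 'a" where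
  "proj c = (THE b. b \<in> derived A \<and> c - b \<in> U)"

text \<open>Two candidates differ by an element of both \<open>U\<close> and [L, L], which is 0.
  Later values of \<open>proj\<close> are found by exhibiting a candidate.\<close>

lemma proj_eqI:
  assumes "b \<in> derived A" "c - b \<in> U"
  shows "proj c = b"
  unfolding proj_def
proof (rule the_equality)
  fix b' assume b': "b' \<in> derived A \<and> c - b' \<in> U"
  have "(c - b) - (c - b') \<in> U"
    using subspace_diff[OF subspace_U] assms(2) b' by blast
  moreover have "b' - b \<in> derived A"
    using subspace_diff[OF subspace_derived] assms(1) b' by blast
  ultimately have "b' - b = 0"
    by (intro U_derived_disjoint) simp_all
  then show "b' = b" by simp
qed (use assms in simp)

lemma proj: "proj c \<in> derived A" "c - proj c \<in> U"
proof -
  obtain u b where ub: "u \<in> U" "b \<in> derived A" "c = u + b"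
    using decomp_U unfolding direct_decomp_def by blast
  then have "proj c = b"
    by (intro proj_eqI) simp_all
  then show "proj c \<in> derived A" "c - proj c \<in> U"
    using ub by simp_all
qed

lemma proj_add: "proj (x + y) = proj x + proj y"
proof (rule proj_eqI)
  show "proj x + proj y \<in> derived A"
    by (intro subspace_add[OF subspace_derived] proj)
  have "(x - proj x) + (y - proj y) \<in> U"
    by (intro subspace_add[OF subspace_U] proj)
  then show "x + y - (proj x + proj y) \<in> U"
    by (simp add: algebra_simps)
qed

lemma proj_scale: "proj (smult A c x) = smult A c (proj x)"
proof (rule proj_eqI)
  show "smult A c (proj x) \<in> derived A"
    by (intro subspace_scale[OF subspace_derived] proj)
  have "smult A c (x - proj x) \<in> U"
    by (intro subspace_scale[OF subspace_U] proj)
  then show "smult A c x - smult A c (proj x) \<in> U"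
    by (simp add: scale_right_diff_distrib)
qed

lemma proj_derived: "b \<in> derived A \<Longrightarrow> proj b = b"
  by (rule proj_eqI) (simp_all add: subspace_0[OF subspace_U])

text \<open>Since \<open>U\<close> and [L, L] are both graded, the two components of
  \<open>c\<close> split by degree. The part of \<open>c\<close> of the wrong degree vanishes, and
  by directness so does its share in [L, L].\<close>

lemma proj_gr:
  assumes c: "c \<in> gr A i"
  shows "proj c \<in> gr A i"
proof -
  obtain b0 b1 where b: "b0 \<in> derived A \<inter> gr A 0" "b1 \<in> derived A \<inter> gr A 1" "proj c = b0 + b1"
    by (rule derived_graded[OF proj(1)])
  obtain u0 u1 where u: "u0 \<in> U \<inter> gr A 0" "u1 \<in> U \<inter> gr A 1" "c - proj c = u0 + u1"
    using graded_U proj(2)[of c] unfolding graded_subspace_def by blast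
  have eq: "c = (b0 + u0) + (b1 + u1)"
    using b(3) u(3) by (simp add: algebra_simps)
  have g: "b0 + u0 \<in> gr A 0" "b1 + u1 \<in> gr A 1"
    using b u by (auto intro: subspace_add[OF subspace_gr])
  have vanish: "x = 0" if "x \<in> derived A" "y \<in> U" "x + y = 0" for x y
    using that subspace_neg[OF subspace_U, of y] by (metis U_derived_disjoint add_eq_0_iff2)
  show ?thesis
  proof (cases i)
    assume zero: "i = 0"
    \<comment> \<open>This difference is \<open>b1 + u1\<close>, so it has both degrees and is
      0.\<close>
    have "c - (b0 + u0) \<in> gr A 0"
      using c g(1) zero by (auto intro: subspace_diff[OF subspace_gr])
    then have "b1 + u1 = 0"
      using g(2) unfolding eq by (intro gr_disjoint[of _ 0 1]) simp_all
    then show ?thesis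
      using vanish[of b1 u1] b u zero by auto
  next
    assume one: "i = 1"
    have "c - (b1 + u1) \<in> gr A 1"
      using c g(2) one by (auto intro: subspace_diff[OF subspace_gr])
    then have "b0 + u0 = 0"
      using g(1) unfolding eq by (intro gr_disjoint[of _ 0 1]) (simp_all add: algebra_simps)
    then show ?thesis
      using vanish[of b0 u0] b u one by auto
  qed
qed

text \<open>Both summands are stable under the twist, so twisting the decomposition of
  \<open>c\<close> gives that of \<open>tw A c\<close>. Invariance of \<open>U\<close> enters the
  proof here.\<close>

lemma proj_tw:
  assumes "tw A ` U \<subseteq> U" and "tw A ` derived A \<subseteq> derived A"
  shows "proj (tw A c) = tw A (proj c)"
proof (rule proj_eqI)
  show "tw A (proj c) \<in> derived A"
    using assms(2) proj(1) by blast
  have "tw A (c - proj c) \<in> U"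
    using assms(1) proj(2) by blast
  moreover have "tw A c = tw A (c - proj c) + tw A (proj c)"
    by (simp flip: linear_comps(5))
  ultimately show "tw A c - tw A (proj c) \<in> U"
    by simp
qed

section \<open>The map phi on one summand: well-definedness and linearity\<close>

lemma phi_ext_eq: "phi_ext A U D D' v = (D (fst v), D' (proj (snd v)))"
  by (simp add: phi_ext_def proj_def split_beta)

lemma phi_ext_add: "phi_ext A U (D + E) (D' + E') = phi_ext A U D D' + phi_ext A U E E'"
  by (simp add: fun_eq_iff phi_ext_eq)

lemma phi_ext_scale:
  "phi_ext A U (smult_fun A c D) (smult_fun A c D') = smult_fun (breve A) c (phi_ext A U D D')"
  by (simp add: fun_eq_iff phi_ext_eq breve_sel)

text \<open>The associated map is evaluated only at values of \<open>proj\<close>, that is on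
  [L, L], where \<open>D\<close> determines it.\<close>

lemma phi_ext_unique:
  assumes "quasi_pair A k \<theta> D D'" "quasi_pair A k \<theta> D E'"
  shows "phi_ext A U D D' = phi_ext A U D E'"
  using quasi_pair_unique[OF assms proj(1)] by (simp add: fun_eq_iff phi_ext_eq)

text \<open>Removes the choice in \<open>phi_at\<close>: any admissible splitting has the same
  homogeneous parts by \<open>hom_end_sum_unique\<close>, and the choice of associated maps does not
  affect \<open>phi_ext\<close>. Any convenient splitting may therefore be used to compute
  \<open>phi_at\<close>.\<close>

lemma phi_at_sum:
  assumes D0: "quasi_pair A k 0 D0 D0'" and D1: "quasi_pair A k 1 D1 D1'"
  shows "phi_at A U k (D0 + D1) = phi_ext A U D0 D0' + phi_ext A U D1 D1'"
  unfolding phi_at_def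
proof (rule some_equality)
  show "\<exists>E0\<in>comm_end A 0. \<exists>E0'\<in>comm_end A 0. \<exists>E1\<in>comm_end A 1. \<exists>E1'\<in>comm_end A 1.
     der_identity A k 0 E0 E0' \<and> der_identity A k 1 E1 E1' \<and> D0 + D1 = E0 + E1 \<and>
     phi_ext A U D0 D0' + phi_ext A U D1 D1' = phi_ext A U E0 E0' + phi_ext A U E1 E1'"
    using D0 D1 unfolding quasi_pair_def by blast
next
  fix E
  assume "\<exists>E0\<in>comm_end A 0. \<exists>E0'\<in>comm_end A 0. \<exists>E1\<in>comm_end A 1. \<exists>E1'\<in>comm_end A 1.
     der_identity A k 0 E0 E0' \<and> der_identity A k 1 E1 E1' \<and> D0 + D1 = E0 + E1 \<and>
     E = phi_ext A U E0 E0' + phi_ext A U E1 E1'"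
  then obtain E0 E0' E1 E1' where E: "quasi_pair A k 0 E0 E0'" "quasi_pair A k 1 E1 E1'"
    and eq: "D0 + D1 = E0 + E1" and ext: "E = phi_ext A U E0 E0' + phi_ext A U E1 E1'"
    unfolding quasi_pair_def by blast
  have "D0 = E0" "D1 = E1"
    using hom_end_sum_unique[OF _ _ _ _ eq] quasi_pairD(3) D0 D1 E by blast+
  then show "E = phi_ext A U D0 D0' + phi_ext A U D1 D1'"
    using phi_ext_unique D0 D1 E ext by metis
qed

lemma QDer_at_cases:
  assumes "D \<in> QDer_at A k"
  obtains D0 D0' D1 D1' where "quasi_pair A k 0 D0 D0'" "quasi_pair A k 1 D1 D1'"
    "D = D0 + D1" "phi_at A U k D = phi_ext A U D0 D0' + phi_ext A U D1 D1'"
  using assms phi_at_sum unfolding QDer_at_iff by blast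

lemma phi_at_homogeneous:
  assumes D: "quasi_pair A k \<theta> D D'"
  shows "phi_at A U k D = phi_ext A U D D'"
proof -
  have z: "phi_ext A U 0 0 = 0"
    by (simp add: fun_eq_iff phi_ext_eq zero_prod_def)
  show ?thesis
  proof (cases \<theta>)
    assume zero: "\<theta> = 0"
    with D show ?thesis
      using phi_at_sum[of k D D' 0 0] quasi_pair_zero[of k 1] by (simp add: z)
  next
    assume one: "\<theta> = 1"
    with D show ?thesis
      using phi_at_sum[of k 0 0 D D'] quasi_pair_zero[of k 0] by (simp add: z)
  qed
qed

lemma phi_at_add:
  assumes "D \<in> QDer_at A k" "E \<in> QDer_at A k"
  shows "phi_at A U k (D + E) = phi_at A U k D + phi_at A U k E"
proof -
  obtain D0 D0' D1 D1' where D: "quasi_pair A k 0 D0 D0'" "quasi_pair A k 1 D1 D1'"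
    "D = D0 + D1" "phi_at A U k D = phi_ext A U D0 D0' + phi_ext A U D1 D1'"
    using assms(1) by (rule QDer_at_cases)
  obtain E0 E0' E1 E1' where E: "quasi_pair A k 0 E0 E0'" "quasi_pair A k 1 E1 E1'"
    "E = E0 + E1" "phi_at A U k E = phi_ext A U E0 E0' + phi_ext A U E1 E1'"
    using assms(2) by (rule QDer_at_cases)
  have "D + E = (D0 + E0) + (D1 + E1)"
    by (simp add: D(3) E(3) algebra_simps)
  then show ?thesis
    using phi_at_sum[OF quasi_pair_add[OF D(1) E(1)] quasi_pair_add[OF D(2) E(2)]]
    by (simp add: D(4) E(4) phi_ext_add algebra_simps)
qed

lemma phi_at_scale:
  assumes "D \<in> QDer_at A k"
  shows "phi_at A U k (smult_fun A c D) = smult_fun (breve A) c (phi_at A U k D)"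
proof -
  obtain D0 D0' D1 D1' where D: "quasi_pair A k 0 D0 D0'" "quasi_pair A k 1 D1 D1'"
    "D = D0 + D1" "phi_at A U k D = phi_ext A U D0 D0' + phi_ext A U D1 D1'"
    using assms(1) by (rule QDer_at_cases)
  have eq: "smult_fun A c D = smult_fun A c D0 + smult_fun A c D1"
    by (simp add: D(3) fun_eq_iff scale_right_distrib)
  have "phi_at A U k (smult_fun A c D) =
      smult_fun (breve A) c (phi_ext A U D0 D0') + smult_fun (breve A) c (phi_ext A U D1 D1')"
    using phi_at_sum[OF quasi_pair_scale[OF D(1)] quasi_pair_scale[OF D(2)]]
    unfolding eq phi_ext_scale .
  then show ?thesis
    by (simp add: D(4) fun_eq_iff B.scale_right_distrib)
qed

section \<open>Evenness and injectivity\<close>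

lemma phi_ext_hom_end:
  assumes D: "D \<in> hom_end A \<theta>" and D': "D' \<in> hom_end A \<theta>"
  shows "phi_ext A U D D' \<in> hom_end (breve A) \<theta>"
  using hom_endD[OF D] hom_endD[OF D'] proj_gr
  by (intro B.hom_endI) (simp_all add: phi_ext_eq breve_sel proj_add proj_scale del: add_bit_eq_xor)

text \<open>Membership in the span only provides a splitting \<open>D0 + D1\<close>. As
  \<open>D\<close> is itself homogeneous, uniqueness of the splitting identifies it with its part of
  degree \<theta>, so \<open>D\<close> has an associated map of its own degree.\<close>

lemma phi_at_even:
  assumes D: "D \<in> QDer_at A k" and hom: "D \<in> hom_end A \<theta>"
  shows "phi_at A U k D \<in> hom_end (breve A) \<theta>"
proof -
  obtain D0 D0' D1 D1' where
    q: "quasi_pair A k 0 D0 D0'" "quasi_pair A k 1 D1 D1'" "D = D0 + D1"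
    using D by (rule QDer_at_cases)
  note D01 = quasi_pairD(3)[OF q(1)] quasi_pairD(3)[OF q(2)]
  note z = fn.subspace_0[OF subspace_hom_end]
  obtain D' where D': "quasi_pair A k \<theta> D D'"
  proof (cases \<theta>)
    assume zero: "\<theta> = 0"
    have "D0 = D"
      by (rule hom_end_sum_unique(1)[OF D01(1) hom[unfolded zero] D01(2) z])
        (simp add: q(3))
    then show thesis
      using that q zero by blast
  next
    assume one: "\<theta> = 1"
    have "D1 = D"
      by (rule hom_end_sum_unique(2)[OF D01(1) z D01(2) hom[unfolded one]])
        (simp add: q(3))
    then show thesis
      using that q one by blast
  qed
  show ?thesis
    unfolding phi_at_homogeneous[OF D'] using D' by (intro phi_ext_hom_end quasi_pairD(3,4))
qed

text \<open>The t-component of the image recovers \<open>D\<close>; this yields injectivity.\<close>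

lemma fst_phi_at:
  assumes "D \<in> QDer_at A k"
  shows "fst (phi_at A U k D (a, c)) = D a"
  using assms by (rule QDer_at_cases) (simp add: phi_ext_eq)

lemma inj_on_phi_at: "inj_on (phi_at A U k) (QDer_at A k)"
  by (rule inj_onI, rule ext) (metis fst_phi_at)

lemma inj_on_phi: "inj_on (phi A U) (QDer A)"
proof (rule inj_onI)
  fix F G assume FG: "F \<in> QDer A" "G \<in> QDer A" "phi A U F = phi A U G"
  show "F = G"
  proof
    fix k
    have "F k \<in> QDer_at A k" "G k \<in> QDer_at A k" "phi_at A U k (F k) = phi_at A U k (G k)"
      using FG by (auto simp: QDer_def dsum_def phi_def fun_eq_iff)
    then show "F k = G k"
      using inj_on_phi_at by (metis inj_onD)
  qed
qed

section \<open>Values among the derivations of \<open>breve A\<close>\<close>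

lemma phi_ext_comm_end:
  assumes tw: "tw A ` U \<subseteq> U" "tw A ` derived A \<subseteq> derived A"
    and D: "D \<in> comm_end A \<theta>" and D': "D' \<in> comm_end A \<theta>"
  shows "phi_ext A U D D' \<in> comm_end (breve A) \<theta>"
  using D D' phi_ext_hom_end unfolding comm_end_def
  by (auto simp: fun_eq_iff phi_ext_eq breve_sel proj_tw[OF tw])

text \<open>The t-components of both sides are 0, the right one because \<open>D 0 = 0\<close>. In
  the t^2-component \<open>proj\<close> fixes the bracket, which leaves the quasiderivation identity
  for the t-components of the arguments.\<close>

lemma phi_ext_der_identity:
  assumes "quasi_pair A k \<theta> D D'"
  shows "der_identity (breve A) k \<theta> (phi_ext A U D D') (phi_ext A U D D')"
  using quasi_pairD(5)[OF assms] hom_endD(3)[OF quasi_pairD(3)[OF assms]]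
  unfolding der_identity_def
  by (simp add: breve_sel breve_tw_power phi_ext_eq proj_derived[OF brk_derived] del: mult_bit_eq_and)

lemma phi_at_Der_at:
  assumes tw: "tw A ` U \<subseteq> U" "tw A ` derived A \<subseteq> derived A" and "D \<in> QDer_at A k"
  shows "phi_at A U k D \<in> Der_at (breve A) k"
proof -
  have "phi_ext A U E E' \<in> Der_at (breve A) k" if "quasi_pair A k \<theta> E E'" for E E' \<theta>
    unfolding Der_at_def
    using phi_ext_comm_end[OF tw quasi_pairD(1,2)[OF that]] phi_ext_der_identity[OF that]
    by (intro fnB.span_base) blast
  then have "phi_ext A U D0 D0' + phi_ext A U D1 D1' \<in> Der_at (breve A) k"
    if "quasi_pair A k 0 D0 D0'" "quasi_pair A k 1 D1 D1'" for D0 D0' D1 D1'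
    using that unfolding Der_at_def by (blast intro: fnB.span_add)
  then show ?thesis
    using \<open>D \<in> QDer_at A k\<close> by (metis QDer_at_cases)
qed

lemma phi_Der:
  assumes tw: "tw A ` U \<subseteq> U" "tw A ` derived A \<subseteq> derived A" and F: "F \<in> QDer A"
  shows "phi A U F \<in> Der (breve A)"
proof -
  \<comment> \<open>Guarantees that the image family is again finitely supported, as membership in
    \<open>dsum\<close> demands.\<close>
  have "phi_at A U k 0 = 0" for k
    using phi_at_homogeneous[OF quasi_pair_zero[of k 0]]
    by (simp add: fun_eq_iff phi_ext_eq zero_prod_def)
  then have "{k. phi A U F k \<noteq> 0} \<subseteq> {k. F k \<noteq> 0}"
    by (auto simp: phi_def)
  moreover have "finite {k. F k \<noteq> 0}" "\<And>k. F k \<in> QDer_at A k"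
    using F by (simp_all add: QDer_def dsum_def)
  ultimately show ?thesis
    unfolding Der_def dsum_def using phi_at_Der_at[OF tw]
    by (auto simp: phi_def intro: finite_subset)
qed

end

section \<open>Twist invariance of [L, L] and the three claims\<close>

lemma (in multiplicative_hom_lie_superalgebra) tw_derived: "tw A ` derived A \<subseteq> derived A"
proof -
  have "subspace {b. tw A b \<in> derived A}"
    by (rule subspaceI)
      (simp_all add: subspace_0[OF subspace_derived] subspace_add[OF subspace_derived]
        subspace_scale[OF subspace_derived])
  \<comment> \<open>By multiplicativity the twist maps brackets to brackets. Only the left
    occurrence of \<open>derived A\<close> is unfolded, so that \<open>brk_derived\<close> still
    applies to the right one.\<close>
  then have "derived A \<subseteq> {b. tw A b \<in> derived A}"
    by (subst (1) derived_def, intro span_minimal) (auto simp: multiplicative brk_derived)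
  then show ?thesis by blast
qed

theorem proposition3p2:
  fixes A :: "('k::field_char_0, 'a::ab_group_add) hom_superalg" and U :: "'a set"
  assumes "multiplicative_hom_lie_superalgebra A"
    and "graded_subspace A U"
    and "direct_decomp U (derived A)"
  shows
    "((\<forall>k. \<forall>D\<in>QDer_at A k. \<forall>E\<in>QDer_at A k. phi_at A U k (D + E) = phi_at A U k D + phi_at A U k E)
      \<and> (\<forall>k c. \<forall>D\<in>QDer_at A k. phi_at A U k (smult_fun A c D) = smult_fun (breve A) c (phi_at A U k D))
      \<and> (\<forall>k \<theta>. phi_at A U k ` (QDer_at A k \<inter> hom_end A \<theta>) \<subseteq> hom_end (breve A) \<theta>))
   \<and> ((\<forall>k. inj_on (phi_at A U k) (QDer_at A k)) \<and> inj_on (phi A U) (QDer A)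
      \<and> (\<forall>k \<theta> D D'. D \<in> comm_end A \<theta> \<and> D' \<in> comm_end A \<theta> \<and> der_identity A k \<theta> D D' \<longrightarrow>
           (\<forall>a. \<forall>b\<in>derived A. \<forall>u\<in>U. phi_at A U k D (a, b + u) = (D a, D' b))))
   \<and> (tw A ` U \<subseteq> U \<longrightarrow>
        (\<forall>k. phi_at A U k ` QDer_at A k \<subseteq> Der_at (breve A) k) \<and> phi A U ` QDer A \<subseteq> Der (breve A))"
proof -
  interpret multiplicative_hom_lie_superalgebra A by fact
  interpret derived_complement A U
    using assms(2,3) by unfold_locales
  have "phi_at A U k D (a, b + u) = (D a, D' b)"
    if "D \<in> comm_end A \<theta> \<and> D' \<in> comm_end A \<theta> \<and> der_identity A k \<theta> D D'" "b \<in> derived A" "u \<in> U"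
    for k \<theta> D D' a b u
    using that phi_at_homogeneous[of k \<theta> D D'] proj_eqI[of b "b + u"]
    by (simp add: quasi_pair_def phi_ext_eq)
  then show ?thesis
    using phi_at_add phi_at_scale phi_at_even inj_on_phi_at inj_on_phi
      phi_at_Der_at[OF _ tw_derived] phi_Der[OF _ tw_derived]
    by (intro conjI allI ballI impI subsetI) blast+
qed

end
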